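(* If $0<\nu<1$, then \[ \int_{0}^{\infty}\frac{dx}{x}\,\sinh(x)\,e^{-2x}\left(\frac{e^{-2x}-2\cos(2\nu\pi)}{\cosh(2x)-\cos(2\nu\pi)}\right)=\frac{\pi}{2}\,\mathrm{cosec}(2\nu\pi)+\log(3)+\frac{1}{4}\sec(\nu\pi)\left(\psi\left(\frac{\nu}{2}\right)-\psi\left(\frac{\nu+1}{2}\right)\right). \]
   Context: Here $\nu$ is a real number, $\psi(z)=\Gamma'(z)/\Gamma(z)$ denotes the digamma function, $\log$ is the real natural logarithm, $\mathrm{cosec}(t)=1/\sin(t)$ and $\sec(t)=1/\cos(t)$.
   Formalization: At ν = 1/2 the right-hand side is undefined, since cosec(2νπ) and sec(νπ) have poles there; for that value the formal theorem states that the right-hand side has a limit as ν → 1/2 and that the integral equals this limit. *)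

theory Defs
  imports "HOL-Analysis.Analysis"
begin

definition cosec :: "real \<Rightarrow> real" where
  "cosec t = 1 / sin t"

definition sec :: "real \<Rightarrow> real" where
  "sec t = 1 / cos t"

(* The library introduces Digamma through a limit; it is the logarithmic derivative of Gamma. *)
lemma Digamma_eq_deriv_Gamma_div_Gamma:
  fixes x :: real
  assumes "x > 0"
  shows "Digamma x = deriv Gamma x / Gamma x"
proof -
  have nonpos: "x \<notin> \<int>\<^sub>\<le>\<^sub>0"
    using assms by (auto elim!: nonpos_Ints_cases)
  have "(Gamma has_field_derivative Gamma x * Digamma x) (at x)"
    using nonpos by (rule has_field_derivative_Gamma)
  hence "deriv Gamma x = Gamma x * Digamma x"
    by (rule DERIV_imp_deriv)
  thus ?thesis
    using nonpos by (simp add: Gamma_eq_zero_iff)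
qed

definition integrand :: "real \<Rightarrow> real \<Rightarrow> real" where
  "integrand \<nu> x =
     1 / x * sinh x * exp (- 2 * x) *
       ((exp (- 2 * x) - 2 * cos (2 * \<nu> * pi)) / (cosh (2 * x) - cos (2 * \<nu> * pi)))"

(* On 0 < \<nu> < 1 the only singularity is \<nu> = 1/2, where both sin (2 * \<nu> * pi) and
   cos (\<nu> * pi) vanish. The singularity is removable, but since 1 / 0 = 0 the value of this
   term at \<nu> = 1/2 is meaningless; there the right-hand side has to be read as a limit. *)
definition closed_form :: "real \<Rightarrow> real" where
  "closed_form \<nu> =
     pi / 2 * cosec (2 * \<nu> * pi) + ln 3
       + 1 / 4 * sec (\<nu> * pi) * (Digamma (\<nu> / 2) - Digamma ((\<nu> + 1) / 2))"

end

(*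
  Cancelling the denominator, the integrand is (e^-x - e^-3x)/x - k(x) with
  k(x) = sinh x / (2 x (sinh^2 x + sin^2 (pi nu))). The first part is a Frullani integral with
  value log 3. For the second part put beta(z) = sum_k (-1)^k/(z+k), which is a difference of
  two digamma values. The imaginary part of beta(z) + beta(1-z) = pi / sin(pi z) at
  z = nu + i x/pi expands 2 cos(pi nu) k(x) as a difference of two series with nonnegative terms
  1/(x^2 + pi^2 a^2) - 1/(x^2 + pi^2 (a+1)^2). Integrating these termwise gives
  (beta(nu) - beta(1-nu))/2, again with beta, and the reflection formula at real nu turns this into
  the closed form. At nu = 1/2, where this argument degenerates, the kernels satisfy
  k_(1/2) <= k_nu <= k_(1/2) + cos^2(pi nu) k_(1/4) near 1/2, so their integrals tend to that of k_(1/2).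
*)
theory Submission
  imports Defs
begin

section \<open>Elementary integrals over the half-line\<close>

text \<open>A bridge from nonnegative Lebesgue integrals, where the fundamental theorem and the
  exchange of integrals need no prior integrability, to gauge integrals.\<close>

lemma nn_integral_indicator_imp_has_integral:
  fixes f :: "'a::euclidean_space \<Rightarrow> real"
  assumes f: "f \<in> borel_measurable borel" and S: "S \<in> sets borel"
    and nonneg: "\<And>x. x \<in> S \<Longrightarrow> 0 \<le> f x"
    and int: "(\<integral>\<^sup>+x. ennreal (f x) * indicator S x \<partial>lborel) = ennreal r" and "0 \<le> r"
  shows "(f has_integral r) S"
proof -
  let ?g = "\<lambda>x. indicator S x * f x"
  have "?g \<in> borel_measurable borel" using f S by measurable
  moreover have "(\<integral>\<^sup>+x. ?g x \<partial>lborel) = ennreal r"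
    unfolding int[symmetric] by (intro nn_integral_cong) (auto simp: indicator_def)
  moreover have "0 \<le> ?g x" for x using nonneg by (auto simp: indicator_def)
  ultimately have "(?g has_integral r) UNIV"
    using \<open>0 \<le> r\<close> by (intro nn_integral_has_integral) auto
  then have "((\<lambda>x. if x \<in> S then f x else 0) has_integral r) UNIV"
    by (rule has_integral_eq[rotated]) (auto simp: indicator_def)
  then show ?thesis by (simp add: has_integral_restrict_UNIV)
qed

lemma has_integral_Ici_imp_Ioi:
  fixes f :: "real \<Rightarrow> real"
  assumes "(f has_integral r) {a..}"
  shows "(f has_integral r) {a<..}"
proof -
  have "(f has_integral r) {a..} \<longleftrightarrow> (f has_integral r) {a<..}"
    by (rule has_integral_spike_set_eq)
       (rule negligible_subset[of "{a}"]; auto)+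
  with assms show ?thesis by simp
qed

text \<open>With \<open>b = pi * a\<close>, an antiderivative is \<open>arctan (x / b) / b\<close>,
  which rises from 0 to \<open>pi / (2 * b)\<close>. The factor \<open>pi\<close> cancels, so
  partial fractions in x turn into plain reciprocals of a.\<close>

lemma has_integral_inverse_quadratic:
  fixes a :: real
  assumes "a > 0"
  shows "((\<lambda>x. 1 / (x\<^sup>2 + pi\<^sup>2 * a\<^sup>2)) has_integral 1 / (2 * a)) {0<..}"
proof (rule has_integral_Ici_imp_Ioi, rule nn_integral_indicator_imp_has_integral)
  define b where "b = pi * a"
  have b: "b > 0" using assms by (simp add: b_def)
  have "((\<lambda>x. arctan (inverse b * x) / b) \<longlongrightarrow> (pi / 2) / b) at_top"
    by (intro tendsto_divide tendsto_const filterlim_compose[OF tendsto_arctan_at_top]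
        filterlim_tendsto_pos_mult_at_top[OF tendsto_const] filterlim_ident) (use b in auto)
  moreover have "((\<lambda>x. arctan (inverse b * x) / b) has_real_derivative 1 / (x\<^sup>2 + b\<^sup>2)) (at x)" for x
  proof -
    have "x\<^sup>2 + b\<^sup>2 = b * b * (1 + (inverse b * x)\<^sup>2)"
      using b by (simp add: field_simps power2_eq_square)
    then have "inverse b / (1 + (inverse b * x)\<^sup>2) / b = 1 / (x\<^sup>2 + b\<^sup>2)"
      by (simp only: inverse_eq_divide divide_divide_eq_left mult_ac)
    moreover have "((\<lambda>x. arctan (inverse b * x) / b) has_real_derivative
        inverse b / (1 + (inverse b * x)\<^sup>2) / b) (at x)"
      by (rule derivative_eq_intros refl)+ (use b in \<open>simp_all add: divide_inverse mult_ac\<close>)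
    ultimately show ?thesis by simp
  qed
  ultimately have "(\<integral>\<^sup>+x. ennreal (1 / (x\<^sup>2 + b\<^sup>2)) * indicator {0..} x \<partial>lborel)
      = ennreal ((pi / 2) / b - arctan (inverse b * 0) / b)"
    by (intro nn_integral_FTC_atLeast) auto
  then show "(\<integral>\<^sup>+x. ennreal (1 / (x\<^sup>2 + pi\<^sup>2 * a\<^sup>2)) * indicator {0..} x \<partial>lborel) = ennreal (1 / (2 * a))"
    by (simp add: b_def power_mult_distrib)
qed (use assms in auto)

text \<open>The quotient is the integral of \<open>exp (- (y * x))\<close> over y from a to b.
  Exchanging the order of integration leaves \<open>1 / y\<close>, and hence the logarithm.\<close>

lemma has_integral_frullani_exp:
  fixes a b :: real
  assumes "0 < a" "a \<le> b"
  shows "((\<lambda>x. (exp (- (a * x)) - exp (- (b * x))) / x) has_integral ln (b / a)) {0<..}"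
proof (rule nn_integral_indicator_imp_has_integral)
  have inner_y: "(\<integral>\<^sup>+y. ennreal (exp (- (y * x))) * indicator {a..b} y \<partial>lborel)
      = ennreal ((exp (- (a * x)) - exp (- (b * x))) / x)" if "x > 0" for x
  proof -
    have "(\<integral>\<^sup>+y. ennreal (exp (- (y * x))) * indicator {a..b} y \<partial>lborel)
      = ennreal (- exp (- (b * x)) / x - (- exp (- (a * x)) / x))"
      by (rule nn_integral_FTC_Icc)
         (use assms that in \<open>auto intro!: derivative_eq_intros simp: field_simps\<close>)
    then show ?thesis by (simp add: diff_divide_distrib)
  qed
  have inner_x: "(\<integral>\<^sup>+x. ennreal (exp (- (y * x))) * indicator {0..} x \<partial>lborel) = ennreal (1 / y)"
    if "y > 0" for y
  proof -
    have "((\<lambda>x. - exp (- (y * x)) / y) \<longlongrightarrow> - 0 / y) at_top"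
      by (intro tendsto_divide tendsto_minus tendsto_const filterlim_compose[OF exp_at_bot]
           filterlim_compose[OF filterlim_uminus_at_bot_at_top]
           filterlim_tendsto_pos_mult_at_top[OF tendsto_const] filterlim_ident) (use that in auto)
    then have "(\<integral>\<^sup>+x. ennreal (exp (- (y * x))) * indicator {0..} x \<partial>lborel)
        = ennreal (- 0 / y - - exp (- (y * 0)) / y)"
      by (intro nn_integral_FTC_atLeast)
         (use that in \<open>auto intro!: derivative_eq_intros\<close>)
    then show ?thesis by simp
  qed
  let ?k = "\<lambda>x y. ennreal (exp (- (y * x))) * indicator {a..b} y * indicator {0<..} x"
  have "(\<integral>\<^sup>+x. ennreal ((exp (- (a * x)) - exp (- (b * x))) / x) * indicator {0<..} x \<partial>lborel)
      = (\<integral>\<^sup>+x. \<integral>\<^sup>+y. ?k x y \<partial>lborel \<partial>lborel)"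
    by (intro nn_integral_cong) (simp add: nn_integral_multc inner_y[symmetric] split: split_indicator)
  also have "\<dots> = (\<integral>\<^sup>+y. \<integral>\<^sup>+x. ?k x y \<partial>lborel \<partial>lborel)"
    by (rule lborel_pair.Fubini') measurable
  also have "\<dots> = (\<integral>\<^sup>+y. ennreal (1 / y) * indicator {a..b} y \<partial>lborel)"
  proof (intro nn_integral_cong)
    fix y :: real
    have "(\<integral>\<^sup>+x. ?k x y \<partial>lborel)
      = (\<integral>\<^sup>+x. ennreal (exp (- (y * x))) * indicator {0..} x * indicator {a..b} y \<partial>lborel)"
      \<comment> \<open>The open and the closed half-line differ only in the null set
        \<open>{0}\<close>.\<close>
      by (intro nn_integral_cong_AE, rule AE_mp[OF AE_lborel_singleton[of 0]])
         (auto simp: indicator_def)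
    also have "\<dots> = ennreal (1 / y) * indicator {a..b} y"
      using inner_x[of y] assms by (subst nn_integral_multc) (auto simp: indicator_def)
    finally show "(\<integral>\<^sup>+x. ?k x y \<partial>lborel) = ennreal (1 / y) * indicator {a..b} y" .
  qed
  also have "\<dots> = ennreal (ln b - ln a)"
    by (rule nn_integral_FTC_Icc)
       (use assms in \<open>auto intro!: derivative_eq_intros simp: field_simps\<close>)
  also have "ln b - ln a = ln (b / a)" using assms by (simp add: ln_div)
  finally show "(\<integral>\<^sup>+x. ennreal ((exp (- (a * x)) - exp (- (b * x))) / x) * indicator {0<..} x \<partial>lborel)
      = ennreal (ln (b / a))" .
next
  fix x :: real assume "x \<in> {0<..}"
  then show "0 \<le> (exp (- (a * x)) - exp (- (b * x))) / x"
    using assms by (auto intro!: divide_nonneg_pos)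
qed (use assms in \<open>auto simp: ln_ge_zero_iff\<close>)

section \<open>Reflection formulas for digamma and the alternating beta function\<close>

text \<open>Both sides of \<open>Gamma z * Gamma (1 - z) = pi / sin (pi * z)\<close> are
  differentiated, and the nonzero product is cancelled. Since z is not an integer, both Gamma
  factors are regular.\<close>

lemma Digamma_reflection_complex:
  fixes z :: complex
  assumes "z \<notin> \<int>"
  shows "Digamma (1 - z) - Digamma z = of_real pi * cos (of_real pi * z) / sin (of_real pi * z)"
proof -
  have z: "z \<notin> \<int>\<^sub>\<le>\<^sub>0" using assms by (auto elim!: nonpos_Ints_cases)
  have z': "1 - z \<notin> \<int>\<^sub>\<le>\<^sub>0"
  proof
    assume "1 - z \<in> \<int>\<^sub>\<le>\<^sub>0"
    then have "1 - (1 - z) \<in> \<int>" using nonpos_Ints_Int by (intro Ints_diff) auto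
    with assms show False by simp
  qed
  define G where "G = Gamma z * Gamma (1 - z)"
  define s where "s = sin (of_real pi * z)"
  have G: "G = of_real pi / s" by (simp add: G_def s_def Gamma_reflection_complex)
  have "G \<noteq> 0" using z z' by (simp add: G_def Gamma_eq_zero_iff)
  then have s: "s \<noteq> 0" using G by auto
  have "((\<lambda>z. Gamma z * Gamma (1 - z)) has_field_derivative
      G * (Digamma z - Digamma (1 - z))) (at z)"
    using z z' by (auto intro!: derivative_eq_intros simp: G_def algebra_simps)
  moreover have "((\<lambda>z. Gamma z * Gamma (1 - z)) has_field_derivative
      - (of_real pi * (of_real pi * cos (of_real pi * z))) / s\<^sup>2) (at z)"
    unfolding Gamma_reflection_complex
    using s by (auto intro!: derivative_eq_intros simp: s_def power2_eq_square)
  ultimately have "G * (Digamma z - Digamma (1 - z))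
      = - (of_real pi * (of_real pi * cos (of_real pi * z))) / s\<^sup>2"
    by (rule DERIV_unique)
  also have "\<dots> = G * (- (of_real pi * cos (of_real pi * z)) / s)"
    by (simp add: G power2_eq_square)
  finally have "Digamma z - Digamma (1 - z) = - (of_real pi * cos (of_real pi * z)) / s"
    using \<open>G \<noteq> 0\<close> unfolding mult_cancel_left by blast
  then show ?thesis by (simp add: s_def algebra_simps minus_equation_iff)
qed

text \<open>The function usually written \<open>\<beta>\<close>, with \<open>\<beta>(z) = \<Sum>k. (-1)^k / (z + k)\<close>.\<close>
definition alt_beta :: "'a \<Rightarrow> 'a :: {real_normed_field,banach}" where
  "alt_beta z = (Digamma ((z + 1) / 2) - Digamma (z / 2)) / 2"

text \<open>The digamma series at \<open>(z + 1) / 2\<close> and \<open>z / 2\<close> are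
  subtracted, so the Euler constant and the harmonic terms cancel. The two conditions say that
  neither digamma argument is zero.\<close>

lemma sums_alt_beta:
  fixes z :: "'a :: {real_normed_field,banach}"
  assumes "z \<noteq> 0" "z \<noteq> -1"
  shows "(\<lambda>k. 1 / (z + of_nat (2 * k)) - 1 / (z + of_nat (2 * k) + 1)) sums alt_beta z"
proof -
  have S: "(\<lambda>n. inverse (of_nat (Suc n)) - inverse (w + of_nat n)) sums (Digamma w + euler_mascheroni)"
    if "w \<noteq> 0" for w :: 'a
    using summable_Digamma[OF that] by (simp add: Digamma_def summable_sums)
  have "z + 1 \<noteq> 0" using assms(2) by (simp add: eq_neg_iff_add_eq_0)
  then have "(z + 1) / 2 \<noteq> 0" "z / 2 \<noteq> 0" using assms by simp_all
  from sums_divide[OF sums_diff[OF S[OF this(1)] S[OF this(2)]], of 2]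
  have "(\<lambda>n. (inverse (z / 2 + of_nat n) - inverse ((z + 1) / 2 + of_nat n)) / 2) sums alt_beta z"
    by (simp add: alt_beta_def)
  moreover have half: "inverse (w / 2 + of_nat n) / 2 = 1 / (w + of_nat (2 * n))" for w :: 'a and n
  proof -
    have "w + of_nat (2 * n) = 2 * (w / 2 + of_nat n)" by (simp add: algebra_simps)
    then show ?thesis by (simp only: inverse_eq_divide divide_divide_eq_left mult.commute)
  qed
  ultimately show ?thesis
    by (simp only: diff_divide_distrib half) (simp add: add_ac)
qed

text \<open>The four digamma values pair up into reflections at \<open>z / 2\<close> and
  \<open>(1 - z) / 2\<close>. With \<open>w = pi * z / 2\<close> these give
  \<open>pi * cot w\<close> and \<open>pi * tan w\<close>, and half their sum is
  \<open>pi / sin (2 * w)\<close>.\<close>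

lemma alt_beta_reflection_complex:
  fixes z :: complex
  assumes "z \<notin> \<int>"
  shows "alt_beta z + alt_beta (1 - z) = of_real pi / sin (of_real pi * z)"
proof -
  define w where "w = of_real pi * (z / 2)"
  have 1: "z / 2 \<notin> \<int>"
  proof
    assume "z / 2 \<in> \<int>"
    then have "2 * (z / 2) \<in> \<int>" by (intro Ints_mult) auto
    with assms show False by simp
  qed
  have 2: "(1 - z) / 2 \<notin> \<int>"
  proof
    assume "(1 - z) / 2 \<in> \<int>"
    then have "1 - 2 * ((1 - z) / 2) \<in> \<int>" by (intro Ints_mult Ints_diff) auto
    also have "1 - 2 * ((1 - z) / 2) = z" by (simp add: field_simps)
    finally show False using assms by simp
  qed
  have sn: "sin (of_real pi * u) \<noteq> 0" if "u \<notin> \<int>" for u :: complex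
  proof
    assume "sin (of_real pi * u) = 0"
    then obtain n :: int where "of_real pi * u = of_real (of_int n * pi)"
      unfolding sin_eq_0 by auto
    then have "u = of_int n" by simp
    with that show False by simp
  qed
  have w: "sin w \<noteq> 0" using sn[OF 1] by (simp add: w_def)
  have arg: "of_real pi * ((1 - z) / 2) = of_real pi / 2 - w"
    by (simp add: w_def algebra_simps diff_divide_distrib)
  have w': "cos w \<noteq> 0" using sn[OF 2] unfolding arg by (simp add: sin_diff)
  have R1: "Digamma (1 - z / 2) - Digamma (z / 2) = of_real pi * cos w / sin w"
    using Digamma_reflection_complex[OF 1] by (simp add: w_def)
  have refl: "1 - (1 - z) / 2 = (z + 1) / 2" by (simp add: field_simps)
  have R2: "Digamma ((z + 1) / 2) - Digamma ((1 - z) / 2) = of_real pi * sin w / cos w"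
    using Digamma_reflection_complex[OF 2] unfolding arg refl by (simp add: sin_diff cos_diff)
  have "(1 - z + 1) / 2 = 1 - z / 2" by (simp add: field_simps)
  then have "alt_beta z + alt_beta (1 - z)
      = ((Digamma (1 - z / 2) - Digamma (z / 2)) + (Digamma ((z + 1) / 2) - Digamma ((1 - z) / 2))) / 2"
    by (simp add: alt_beta_def field_simps)
  also have "\<dots> = of_real pi * ((cos w)\<^sup>2 + (sin w)\<^sup>2) / (2 * sin w * cos w)"
    unfolding R1 R2 using w w'
    by (simp add: field_simps power2_eq_square) (simp flip: distrib_left)
  also have "\<dots> = of_real pi / sin (2 * w)"
    unfolding sin_double by (simp add: sin_cos_squared_add2)
  finally show ?thesis by (simp add: w_def)
qed

text \<open>Lets the reflection formula, proved for complex arguments, be used at real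
  \<nu>.\<close>

lemma alt_beta_of_real:
  fixes x :: real
  assumes "x \<noteq> 0" "x \<noteq> -1"
  shows "alt_beta (of_real x :: 'a :: {real_normed_field,banach}) = of_real (alt_beta x)"
  using assms Polygamma_of_real[of "x / 2" 0, where 'a = 'a]
    Polygamma_of_real[of "(x + 1) / 2" 0, where 'a = 'a]
  by (simp add: alt_beta_def eq_neg_iff_add_eq_0)

section \<open>Partial fractions and the integral of the kernel\<close>

text \<open>The factor \<open>2 * (sinh\<^sup>2 + sin\<^sup>2)\<close> is
  \<open>cosh (2 * x) - cos (2 * pi * \<nu>)\<close>. As a sum of squares it is visibly positive for
  x > 0 and monotone in the square of the sine.\<close>

definition kernel :: "real \<Rightarrow> real \<Rightarrow> real" where
  "kernel \<nu> x = sinh x / (2 * x * ((sinh x)\<^sup>2 + (sin (pi * \<nu>))\<^sup>2))"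

text \<open>Neighbouring terms of an alternating series are paired, so that each summand is
  nonnegative when a > 0 and monotone convergence becomes available.\<close>

definition alt_fractions :: "real \<Rightarrow> nat \<Rightarrow> real \<Rightarrow> real" where
  "alt_fractions a k x =
     1 / (x\<^sup>2 + pi\<^sup>2 * (a + of_nat (2 * k))\<^sup>2) - 1 / (x\<^sup>2 + pi\<^sup>2 * (a + of_nat (2 * k) + 1)\<^sup>2)"

lemma alt_fractions_nonneg:
  assumes "a > 0"
  shows "0 \<le> alt_fractions a k x"
proof -
  have "0 < x\<^sup>2 + pi\<^sup>2 * (a + of_nat (2 * k))\<^sup>2"
    using assms by (intro add_nonneg_pos mult_pos_pos zero_less_power add_pos_nonneg) auto
  moreover have "(a + of_nat (2 * k))\<^sup>2 \<le> (a + of_nat (2 * k) + 1)\<^sup>2"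
    using assms by (intro power_mono) auto
  ultimately show ?thesis
    unfolding alt_fractions_def by (simp add: frac_le mult_left_mono del: of_nat_mult)
qed

text \<open>Each summand integrates to half the corresponding term of the series of
  \<open>alt_beta a\<close>. The partial sums increase, so monotone convergence gives the integral
  of the limit.\<close>

lemma has_integral_suminf_alt_fractions:
  assumes "a > 0" and sums: "\<And>x. x > 0 \<Longrightarrow> (\<lambda>k. alt_fractions a k x) sums F x"
  shows "(F has_integral alt_beta a / 2) {0<..}"
proof (rule has_integral_monotone_convergence_increasing)
  fix n
  show "((\<lambda>x. \<Sum>k<n. alt_fractions a k x) has_integral
      (\<Sum>k<n. (1 / (a + of_nat (2 * k)) - 1 / (a + of_nat (2 * k) + 1)) / 2)) {0<..}"
  proof (rule has_integral_sum)
    fix k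
    have "((\<lambda>x. alt_fractions a k x) has_integral
      1 / (2 * (a + of_nat (2 * k))) - 1 / (2 * (a + of_nat (2 * k) + 1))) {0<..}"
      unfolding alt_fractions_def
      by (intro has_integral_diff has_integral_inverse_quadratic) (use \<open>a > 0\<close> in auto)
    then show "((\<lambda>x. alt_fractions a k x) has_integral
      (1 / (a + of_nat (2 * k)) - 1 / (a + of_nat (2 * k) + 1)) / 2) {0<..}"
      by (simp add: diff_divide_distrib mult.commute)
  qed auto
next
  show "(\<lambda>n. \<Sum>k<n. (1 / (a + of_nat (2 * k)) - 1 / (a + of_nat (2 * k) + 1)) / 2)
      \<longlonglongrightarrow> alt_beta a / 2"
    using sums_divide[OF sums_alt_beta[of a]] \<open>a > 0\<close> by (simp add: sums_def)
next
  fix x :: real assume "x \<in> {0<..}"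
  then show "(\<lambda>n. \<Sum>k<n. alt_fractions a k x) \<longlonglongrightarrow> F x"
    using sums by (simp add: sums_def)
qed (use alt_fractions_nonneg[OF \<open>a > 0\<close>] in auto)

text \<open>Imaginary parts are taken in the series of \<open>alt_beta\<close>. Both signs of the
  imaginary part of the argument occur later, because z and \<open>1 - z\<close> have opposite
  ones.\<close>

lemma sums_alt_fractions:
  assumes "a > 0" "x \<noteq> 0"
  shows "(\<lambda>k. alt_fractions a k x) sums (- Im (alt_beta (Complex a (x / pi))) / (pi * x))"
    and "(\<lambda>k. alt_fractions a k x) sums (Im (alt_beta (Complex a (- (x / pi)))) / (pi * x))"
proof -
  have Im: "Im (1 / (Complex b (y / pi))) = - (pi * y) * (1 / (y\<^sup>2 + pi\<^sup>2 * b\<^sup>2))" for b y :: real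
  proof -
    have "b\<^sup>2 + (y / pi)\<^sup>2 = (y\<^sup>2 + pi\<^sup>2 * b\<^sup>2) / pi\<^sup>2"
      by (simp add: field_simps)
    then have "Im (1 / (Complex b (y / pi))) = - (y / pi) / ((y\<^sup>2 + pi\<^sup>2 * b\<^sup>2) / pi\<^sup>2)"
      by (simp add: Im_divide)
    then show ?thesis by (simp add: power2_eq_square)
  qed
  \<comment> \<open>Here y stands for x or -x: the fractions depend only on its square, while the
    factor \<open>pi * y\<close> carries the sign.\<close>
  have *: "(\<lambda>k. alt_fractions a k x) sums (- Im (alt_beta (Complex a (y / pi))) / (pi * y))"
    if "y \<noteq> 0" "y\<^sup>2 = x\<^sup>2" for y
  proof -
    let ?z = "Complex a (y / pi)"
    have "?z \<noteq> 0" "?z \<noteq> -1" using that by (auto simp: complex_eq_iff)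
    from sums_Im[OF sums_alt_beta[OF this]]
    have "(\<lambda>k. Im (1 / (?z + of_nat (2 * k)) - 1 / (?z + of_nat (2 * k) + 1))) sums Im (alt_beta ?z)" .
    moreover have "Im (1 / (?z + of_nat (2 * k)) - 1 / (?z + of_nat (2 * k) + 1))
        = - (pi * y) * alt_fractions a k x" for k
    proof -
      have "?z + of_nat (2 * k) = Complex (a + of_nat (2 * k)) (y / pi)"
        "?z + of_nat (2 * k) + 1 = Complex (a + of_nat (2 * k) + 1) (y / pi)"
        by (simp_all add: complex_eq_iff)
      then show ?thesis
        unfolding alt_fractions_def \<open>y\<^sup>2 = x\<^sup>2\<close>[symmetric]
        by (simp only: minus_complex.sel Im right_diff_distrib)
    qed
    ultimately have "(\<lambda>k. - (pi * y) * alt_fractions a k x) sums Im (alt_beta ?z)" by simp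
    from sums_divide[OF this, of "- (pi * y)"] show ?thesis using that by simp
  qed
  show "(\<lambda>k. alt_fractions a k x) sums (- Im (alt_beta (Complex a (x / pi))) / (pi * x))"
    using * assms by blast
  show "(\<lambda>k. alt_fractions a k x) sums (Im (alt_beta (Complex a (- (x / pi)))) / (pi * x))"
    using *[of "- x"] assms by simp
qed

text \<open>From \<open>sin (u + i x) = sin u * cosh x + i * cos u * sinh x\<close>, whose squared
  modulus is the denominator. This is where the denominator of \<open>kernel\<close> comes
  from.\<close>

lemma Im_inverse_sin:
  "Im (1 / sin (Complex u x)) = - (cos u * sinh x) / ((sinh x)\<^sup>2 + (sin u)\<^sup>2)"
proof -
  have "(sin u * cosh x)\<^sup>2 + (cos u * sinh x)\<^sup>2 = (sinh x)\<^sup>2 + (sin u)\<^sup>2"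
    by (simp add: power_mult_distrib cosh_square_eq cos_squared_eq algebra_simps)
  moreover have "Re (sin (Complex u x)) = sin u * cosh x" "Im (sin (Complex u x)) = cos u * sinh x"
    by (simp_all add: Re_sin Im_sin cosh_def sinh_def)
  ultimately show ?thesis by (simp add: Im_divide)
qed

text \<open>The imaginary part of the reflection formula at \<open>z = \<nu> + i x / pi\<close>. The
  two terms on the left are sums of \<open>alt_fractions\<close> with parameters \<nu> and
  \<open>1 - \<nu>\<close>.\<close>

lemma alt_beta_Im_diff:
  assumes "0 < \<nu>" "\<nu> < 1" "x > 0"
  shows "- Im (alt_beta (Complex \<nu> (x / pi))) / (pi * x)
      - Im (alt_beta (Complex (1 - \<nu>) (- (x / pi)))) / (pi * x) = 2 * cos (pi * \<nu>) * kernel \<nu> x"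
proof -
  let ?z = "Complex \<nu> (x / pi)"
  have "?z \<notin> \<int>" using assms by (auto elim!: Ints_cases simp: complex_eq_iff)
  moreover have "1 - ?z = Complex (1 - \<nu>) (- (x / pi))" "of_real pi * ?z = Complex (pi * \<nu>) x"
    by (simp_all add: complex_eq_iff)
  moreover define w where "w = 1 / sin (Complex (pi * \<nu>) x)"
  ultimately have sum: "alt_beta ?z + alt_beta (Complex (1 - \<nu>) (- (x / pi))) = of_real pi * w"
    using alt_beta_reflection_complex[of ?z] by simp
  define D where "D = (sinh x)\<^sup>2 + (sin (pi * \<nu>))\<^sup>2"
  from arg_cong[OF sum, of Im]
  have "Im (alt_beta ?z) + Im (alt_beta (Complex (1 - \<nu>) (- (x / pi))))
      = - pi * (cos (pi * \<nu>) * sinh x) / D"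
    by (simp add: w_def[THEN arg_cong[of _ _ Im], unfolded Im_inverse_sin] D_def)
  moreover have "- P / (pi * x) - Q / (pi * x) = - (P + Q) / (pi * x)" for P Q :: real
    by (simp add: diff_divide_distrib)
  ultimately have "- Im (alt_beta ?z) / (pi * x)
      - Im (alt_beta (Complex (1 - \<nu>) (- (x / pi)))) / (pi * x)
      = - (- pi * (cos (pi * \<nu>) * sinh x) / D) / (pi * x)"
    by (simp only:)
  then show ?thesis by (simp add: kernel_def D_def[symmetric] mult_ac)
qed

text \<open>The two sums are integrated separately and the common factor
  \<open>2 * cos (pi * \<nu>)\<close> is divided out. It is nonzero because \<nu> differs from
  1/2.\<close>

lemma has_integral_kernel:
  assumes "0 < \<nu>" "\<nu> < 1" "\<nu> \<noteq> 1 / 2"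
  shows "(kernel \<nu> has_integral (alt_beta \<nu> - alt_beta (1 - \<nu>)) / (4 * cos (pi * \<nu>))) {0<..}"
proof -
  have cos: "cos (pi * \<nu>) \<noteq> 0"
  proof
    assume "cos (pi * \<nu>) = 0"
    have "pi * \<nu> = pi * (1 / 2)"
    proof (rule cos_inj_pi)
      show "cos (pi * \<nu>) = cos (pi * (1 / 2))"
        using \<open>cos (pi * \<nu>) = 0\<close> by simp
    qed (use assms in simp_all)
    with assms show False
      unfolding mult_cancel_left using pi_neq_zero by blast
  qed
  have "((\<lambda>x. - Im (alt_beta (Complex \<nu> (x / pi))) / (pi * x)
      - Im (alt_beta (Complex (1 - \<nu>) (- (x / pi)))) / (pi * x))
      has_integral alt_beta \<nu> / 2 - alt_beta (1 - \<nu>) / 2) {0<..}"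
    using assms
    by (intro has_integral_diff has_integral_suminf_alt_fractions sums_alt_fractions) auto
  then have "((\<lambda>x. 2 * cos (pi * \<nu>) * kernel \<nu> x)
      has_integral alt_beta \<nu> / 2 - alt_beta (1 - \<nu>) / 2) {0<..}"
    using assms by (elim has_integral_eq[rotated]) (rule alt_beta_Im_diff, auto)
  from has_integral_divide[OF this, of "2 * cos (pi * \<nu>)"]
  have "(kernel \<nu> has_integral (alt_beta \<nu> / 2 - alt_beta (1 - \<nu>) / 2) / (2 * cos (pi * \<nu>))) {0<..}"
    using cos by simp
  then show ?thesis by (simp add: diff_divide_distrib)
qed

section \<open>Reduction of the integrand and of the closed form\<close>

text \<open>In the notation of the proof, \<open>q * (q - 2 * c) = 2 * q * (C - c) - 1\<close>.
  Dividing by \<open>C - c\<close> separates a Frullani integrand, free of \<nu>, from the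
  kernel.\<close>

lemma integrand_eq:
  assumes "x > 0"
  shows "integrand \<nu> x = (exp (- (1 * x)) - exp (- (3 * x))) / x - kernel \<nu> x"
proof -
  define q where "q = exp (- 2 * x)"
  define C where "C = cosh (2 * x)"
  define c where "c = cos (2 * \<nu> * pi)"
  define D where "D = (sinh x)\<^sup>2 + (sin (pi * \<nu>))\<^sup>2"
  have "D > 0" unfolding D_def
    using assms by (intro add_pos_nonneg zero_less_power) auto
  have "c = 1 - 2 * (sin (pi * \<nu>))\<^sup>2"
    using cos_double_sin[of "pi * \<nu>"] by (simp add: c_def mult_ac)
  moreover have "C = 1 + 2 * (sinh x)\<^sup>2"
    by (simp add: C_def cosh_double cosh_square_eq)
  ultimately have D: "C - c = 2 * D" by (simp add: D_def)
  have "exp (2 * x) * q = 1" by (simp add: q_def flip: exp_add)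
  then have "2 * q * C = q * q + 1"
    by (simp add: C_def cosh_def q_def algebra_simps)
  then have "q * (q - 2 * c) = 2 * q * (C - c) - 1" by (simp add: algebra_simps)
  then have "q * (q - 2 * c) / (C - c) = 2 * q - 1 / (2 * D)"
    unfolding D using \<open>D > 0\<close> by (simp add: field_simps)
  moreover have "2 * q * sinh x = exp (- x) - exp (- 3 * x)"
    by (simp add: q_def sinh_def algebra_simps flip: exp_add)
  moreover have "integrand \<nu> x = (q * (q - 2 * c) / (C - c)) * sinh x / x"
    by (simp add: integrand_def q_def C_def c_def mult_ac)
  ultimately have "integrand \<nu> x = (2 * q * sinh x - sinh x / (2 * D)) / x"
    by (simp add: left_diff_distrib)
  with \<open>2 * q * sinh x = _\<close> show ?thesis
    by (simp add: kernel_def D_def diff_divide_distrib mult_ac)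
qed

lemma has_integral_integrand:
  assumes "(kernel \<nu> has_integral J) {0<..}"
  shows "(integrand \<nu> has_integral ln 3 - J) {0<..}"
proof -
  have "((\<lambda>x. (exp (- (1 * x)) - exp (- (3 * x))) / x) has_integral ln (3 :: real)) {0<..}"
    using has_integral_frullani_exp[of 1 3] by simp
  from has_integral_diff[OF this assms] show ?thesis
    by (rule has_integral_eq[rotated]) (simp only: greaterThan_iff integrand_eq)
qed

text \<open>Reflection at real \<nu> eliminates \<open>alt_beta (1 - \<nu>)\<close>. The term
  \<open>pi / sin (pi * \<nu>)\<close> yields the cosecant by the double angle formula, and the
  remaining \<open>2 * alt_beta \<nu>\<close> is the digamma difference up to sign.\<close>

lemma closed_form_eq:
  assumes "0 < \<nu>" "\<nu> < 1" "\<nu> \<noteq> 1 / 2"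
  shows "closed_form \<nu> = ln 3 - (alt_beta \<nu> - alt_beta (1 - \<nu>)) / (4 * cos (pi * \<nu>))"
proof -
  have "complex_of_real \<nu> \<notin> \<int>" using assms by (auto elim!: Ints_cases simp: complex_eq_iff)
  from alt_beta_reflection_complex[OF this] assms
  have "complex_of_real (alt_beta \<nu> + alt_beta (1 - \<nu>)) = complex_of_real (pi / sin (pi * \<nu>))"
    using alt_beta_of_real[of \<nu>, where 'a = complex] alt_beta_of_real[of "1 - \<nu>", where 'a = complex]
    by (simp flip: sin_of_real)
  then have refl: "alt_beta (1 - \<nu>) = pi / sin (pi * \<nu>) - alt_beta \<nu>"
    unfolding of_real_eq_iff by simp
  have "sin (2 * \<nu> * pi) = 2 * sin (pi * \<nu>) * cos (pi * \<nu>)"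
    using sin_double[of "pi * \<nu>"] by (simp add: mult_ac)
  moreover have "Digamma (\<nu> / 2) - Digamma ((\<nu> + 1) / 2) = - 2 * alt_beta \<nu>"
    by (simp add: alt_beta_def)
  ultimately show ?thesis
    unfolding closed_form_def refl
    by (simp add: cosec_def sec_def diff_divide_distrib mult_ac)
qed

section \<open>The removable singularity at \<nu> = 1/2\<close>

text \<open>The kernel decreases in the square of the sine, which attains its maximum 1 at \<nu> =
  1/2.\<close>

lemma kernel_one_half_le:
  assumes "x > 0"
  shows "0 \<le> kernel (1 / 2) x" "kernel (1 / 2) x \<le> kernel \<nu> x"
proof -
  show "0 \<le> kernel (1 / 2) x" using assms by (simp add: kernel_def)
  have "(sinh x)\<^sup>2 + (sin (pi * \<nu>))\<^sup>2 > 0"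
    using assms by (intro add_pos_nonneg zero_less_power) auto
  then show "kernel (1 / 2) x \<le> kernel \<nu> x"
    using assms unfolding kernel_def
    by (intro divide_left_mono mult_left_mono add_left_mono)
       (auto simp: abs_square_le_1 add_pos_nonneg)
qed

text \<open>With S and s as in the proof, the reciprocals \<open>1 / (S + s)\<close> and
  \<open>1 / (S + 1)\<close> differ by \<open>(1 - s) / ((S + s) * (S + 1))\<close>, at most
  \<open>(1 - s) / (S + 1 / 2)\<close>. The parameter 1/4 appears because
  \<open>sin (pi / 4)\<close> has square 1/2.\<close>

lemma kernel_le:
  assumes "x > 0" and half: "(sin (pi * \<nu>))\<^sup>2 \<ge> 1 / 2"
  shows "kernel \<nu> x \<le> kernel (1 / 2) x + (cos (pi * \<nu>))\<^sup>2 * kernel (1 / 4) x"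
proof -
  define S where "S = (sinh x)\<^sup>2"
  define s where "s = (sin (pi * \<nu>))\<^sup>2"
  have sin_half: "(sin (pi * (1 / 2)))\<^sup>2 = 1" and sin_quarter: "(sin (pi * (1 / 4)))\<^sup>2 = 1 / 2"
    by (simp_all add: sin_45 power_divide)
  have S: "S \<ge> 0" by (simp add: S_def)
  have s: "1 / 2 \<le> s" "s \<le> 1" using half by (simp_all add: s_def abs_square_le_1)
  have c: "(cos (pi * \<nu>))\<^sup>2 = 1 - s" by (simp add: s_def cos_squared_eq)
  have k: "kernel m x = sinh x / (2 * x) * (1 / (S + (sin (pi * m))\<^sup>2))" for m
    by (simp add: kernel_def S_def)
  have "1 / (S + s) - 1 / (S + 1) = (1 - s) / ((S + s) * (S + 1))"
    using S s by (simp add: field_simps)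
  also have "\<dots> \<le> (1 - s) / ((S + 1 / 2) * 1)"
    using S s by (intro divide_left_mono mult_mono mult_pos_pos) auto
  finally have "1 / (S + s) \<le> 1 / (S + 1) + (1 - s) * (1 / (S + 1 / 2))"
    by simp
  then have "sinh x / (2 * x) * (1 / (S + s))
      \<le> sinh x / (2 * x) * (1 / (S + 1) + (1 - s) * (1 / (S + 1 / 2)))"
    using assms by (intro mult_left_mono) auto
  also have "\<dots> = sinh x / (2 * x) * (1 / (S + 1))
      + (1 - s) * (sinh x / (2 * x) * (1 / (S + 1 / 2)))"
    by (simp only: distrib_left mult.left_commute)
  finally show ?thesis
    unfolding c k sin_half sin_quarter s_def[symmetric] .
qed

text \<open>The formula for the kernel integral would divide by zero here, so integrability comes
  from domination by the kernel at 1/4.\<close>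

lemma integrable_kernel_one_half: "kernel (1 / 2) integrable_on {0<..}"
proof (rule measurable_bounded_by_integrable_imp_integrable_real)
  have "continuous_on {0<..} (kernel (1 / 2))"
    unfolding kernel_def
    by (intro continuous_intros) (auto simp: add_nonneg_eq_0_iff)
  then show "kernel (1 / 2) \<in> borel_measurable (lebesgue_on {0<..})"
    by (intro continuous_imp_measurable_on_sets_lebesgue) auto
  show "kernel (1 / 4) integrable_on {0<..}"
    using has_integral_kernel[of "1 / 4"] by auto
qed (use kernel_one_half_le in auto)

theorem theorem3:
  fixes \<nu> :: real
  assumes "0 < \<nu>" and "\<nu> < 1"
  shows "(\<nu> \<noteq> 1/2 \<longrightarrow> (integrand \<nu> has_integral closed_form \<nu>) {0<..}) \<and>
         (\<nu> = 1/2 \<longrightarrow> (\<exists>I. (closed_form \<longlongrightarrow> I) (at \<nu>) \<and> (integrand \<nu> has_integral I) {0<..}))"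
proof (intro conjI impI)
  assume "\<nu> \<noteq> 1/2"
  then show "(integrand \<nu> has_integral closed_form \<nu>) {0<..}"
    using has_integral_integrand[OF has_integral_kernel[of \<nu>]] closed_form_eq[of \<nu>] assms by simp
next
  assume \<nu>: "\<nu> = 1/2"
  \<comment> \<open>Neither value is computed: J only has to be the limit, and K only a finite
    constant in the error bound.\<close>
  define J where "J = integral {0<..} (kernel (1 / 2))"
  define K where "K = integral {0<..} (kernel (1 / 4))"
  have J: "(kernel (1 / 2) has_integral J) {0<..}"
    using integrable_kernel_one_half by (simp add: J_def has_integral_integral)
  have K: "(kernel (1 / 4) has_integral K) {0<..}"
    using has_integral_kernel[of "1 / 4"] by (auto simp: K_def has_integral_iff)
  have bound: "norm (closed_form \<mu> - (ln 3 - J)) \<le> (cos (pi * \<mu>))\<^sup>2 * K"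
    if "\<mu> \<in> {0<..<1}" "\<mu> \<noteq> 1 / 2" "1 / 2 < (sin (pi * \<mu>))\<^sup>2" for \<mu>
  proof -
    have ker: "(kernel \<mu> has_integral ln 3 - closed_form \<mu>) {0<..}"
      using has_integral_kernel[of \<mu>] closed_form_eq[of \<mu>] that by simp
    \<comment> \<open>Integrating the two kernel inequalities encloses the kernel integral at \<mu>
      between J and J plus a small error.\<close>
    have "J \<le> ln 3 - closed_form \<mu>"
      by (rule has_integral_le[OF J ker]) (simp add: kernel_one_half_le)
    moreover have "ln 3 - closed_form \<mu> \<le> J + (cos (pi * \<mu>))\<^sup>2 * K"
      by (rule has_integral_le[OF ker has_integral_add[OF J has_integral_mult_right[OF K]]])
         (use that kernel_le in auto)
    ultimately show ?thesis unfolding real_norm_def abs_le_iff by linarith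
  qed
  \<comment> \<open>By continuity the squared sine exceeds 1/2 near 1/2, as \<open>bound\<close>
    requires.\<close>
  have "((\<lambda>\<mu>. (sin (pi * \<mu>))\<^sup>2) \<longlongrightarrow> (sin (pi * (1 / 2)))\<^sup>2) (at (1 / 2 :: real))"
    by (intro tendsto_intros)
  then have "\<forall>\<^sub>F \<mu> in at (1 / 2). 1 / 2 < (sin (pi * \<mu> :: real))\<^sup>2"
    by (rule order_tendstoD(1)) simp
  moreover have "\<forall>\<^sub>F \<mu> in at (1 / 2). \<mu> \<in> {0<..<1 :: real} \<and> \<mu> \<noteq> 1 / 2"
    using eventually_at_in_open[of "{0<..<1 :: real}" "1 / 2"] by simp
  ultimately have "\<forall>\<^sub>F \<mu> in at (1 / 2). norm (closed_form \<mu> - (ln 3 - J)) \<le> (cos (pi * \<mu>))\<^sup>2 * K"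
    by eventually_elim (use bound in auto)
  \<comment> \<open>The error vanishes in the limit since \<open>cos (pi / 2) = 0\<close>.\<close>
  moreover have "((\<lambda>\<mu>. (cos (pi * \<mu>))\<^sup>2 * K) \<longlongrightarrow> (cos (pi * (1 / 2)))\<^sup>2 * K) (at (1 / 2 :: real))"
    by (intro tendsto_intros)
  then have "((\<lambda>\<mu>. (cos (pi * \<mu>))\<^sup>2 * K) \<longlongrightarrow> 0) (at (1 / 2 :: real))"
    by simp
  ultimately have "((\<lambda>\<mu>. closed_form \<mu> - (ln 3 - J)) \<longlongrightarrow> 0) (at (1 / 2))"
    by (rule Lim_null_comparison)
  then have "(closed_form \<longlongrightarrow> ln 3 - J) (at (1 / 2))"
    by (rule LIM_zero_cancel)
  then show "\<exists>I. (closed_form \<longlongrightarrow> I) (at \<nu>) \<and> (integrand \<nu> has_integral I) {0<..}"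
    unfolding \<nu> using has_integral_integrand[OF J] by blast
qed

end
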